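(* Let $\alpha\in(0,1)$ and let $r,d\ge 1$ be integers. Then for every integer $n\ge 1$, $$p_n^{r,d}=\frac12+\frac1\pi\int_0^1 Q_\alpha(x)^n\,(1-x^2)^{-1/2}\,P_\alpha^{r,d}(x)\,dx,$$ where $$Q_\alpha(x):=1-4\alpha(1-\alpha)(1-x^2)$$ and $$P_\alpha^{r,d}(x):=\sum_{j=0}^{r+d}\left.\frac{d^{2j}}{dt^{2j}}\Bigl(t^{\,j-d}(1-\alpha+\alpha t)^r\Bigr)\right|_{t=-1}\cdot\frac{(2x)^{2j}}{(2j)!}.$$ As a consequence, $$\lim_{n\to\infty}\sqrt n\,\Bigl(p_n^{r,d}-\frac12\Bigr)=\frac{1}{4\sqrt\pi}\,\frac{2\alpha r-2d+1}{\sqrt{\alpha(1-\alpha)}}.$$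
   Context: Let $\{X_i,X_i'\}_{i\ge1}$ be independent identically distributed random variables with $\mathbb{P}\{X_i=1\}=\alpha$ and $\mathbb{P}\{X_i=0\}=1-\alpha$. Put $S_k=X_1+\dots+X_k$ and $S_n'=X_1'+\dots+X_n'$, so that $S_k$ and $S_n'$ are independent binomial random variables. Define $p_n^{r,d}:=\mathbb{P}\{S_{n+r}\ge S_n'+d\}$. In the definition of $P_\alpha^{r,d}$, the symbol $d$ in $\frac{d^{2j}}{dt^{2j}}$ and $dx$ is the differentiation symbol, while $d$ in $t^{j-d}$ and $r+d$ is the given integer. *)

theory Defs
  imports "HOL-Probability.Probability"
begin

text \<open>
  The two sequences are indexed by the positive integers, and the whole family
  \<open>X 1, X 2, \<dots>, X' 1, X' 2, \<dots>\<close> is jointly independent (index set a disjoint sum). The point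
  probabilities determine the law of each variable, so the variables are identically distributed.
\<close>

definition iid_bernoulli_pair ::
  "'a measure \<Rightarrow> real \<Rightarrow> (nat \<Rightarrow> 'a \<Rightarrow> real) \<Rightarrow> (nat \<Rightarrow> 'a \<Rightarrow> real) \<Rightarrow> bool" where
  "iid_bernoulli_pair M \<alpha> X X' \<longleftrightarrow>
     prob_space.indep_vars M (\<lambda>_. borel) (case_sum X X') ({1..} <+> {1..}) \<and>
     (\<forall>i\<ge>1. measure M {\<omega> \<in> space M. X i \<omega> = 1} = \<alpha> \<and>
            measure M {\<omega> \<in> space M. X i \<omega> = 0} = 1 - \<alpha> \<and>
            measure M {\<omega> \<in> space M. X' i \<omega> = 1} = \<alpha> \<and>
            measure M {\<omega> \<in> space M. X' i \<omega> = 0} = 1 - \<alpha>)"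

definition partial_sum :: "(nat \<Rightarrow> 'a \<Rightarrow> real) \<Rightarrow> nat \<Rightarrow> 'a \<Rightarrow> real" where
  "partial_sum X k \<omega> = (\<Sum>i=1..k. X i \<omega>)"

definition lead_prob ::
  "'a measure \<Rightarrow> (nat \<Rightarrow> 'a \<Rightarrow> real) \<Rightarrow> (nat \<Rightarrow> 'a \<Rightarrow> real) \<Rightarrow> nat \<Rightarrow> nat \<Rightarrow> nat \<Rightarrow> real" where
  "lead_prob M X X' r d n =
     measure M {\<omega> \<in> space M. partial_sum X (n + r) \<omega> \<ge> partial_sum X' n \<omega> + real d}"

definition Q_poly :: "real \<Rightarrow> real \<Rightarrow> real" where
  "Q_poly \<alpha> x = 1 - 4 * \<alpha> * (1 - \<alpha>) * (1 - x\<^sup>2)"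

text \<open>
  The exponent \<open>j - d\<close> may be negative, hence the integer power. The differentiated function is
  smooth near \<open>-1\<close>, so the iterated \<open>deriv\<close> there is the genuine derivative; the
  value of \<open>powi\<close> at \<open>0\<close> plays no role.
\<close>

definition P_poly :: "real \<Rightarrow> nat \<Rightarrow> nat \<Rightarrow> real \<Rightarrow> real" where
  "P_poly \<alpha> r d x =
     (\<Sum>j=0..r+d.
        (deriv ^^ (2 * j)) (\<lambda>t::real. t powi (int j - int d) * (1 - \<alpha> + \<alpha> * t) ^ r) (-1)
        * ((2 * x) ^ (2 * j) / fact (2 * j)))"

end

(*
  For l >= 0 let U_{2l} be the Chebyshev polynomial of the second kind, and extend it by
  U_{-2m} = - U_{2m-2}, so that U_{2l}(cos t) = sin((2l+1)t) / sin t for every integer l. The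
  integral of U_{2l}(cos t) over [0, pi/2] is pi/2 or -pi/2 according to the sign of 2l+1, hence
  1/2 + (1/pi) times the integral of U_{-2m}(cos t) is the indicator of 0 >= m. Conditioning on one
  more X and one more X' acts on the tails P(S_n >= S'_n + m) exactly as multiplication by Q(cos t)
  acts on U_{-2m}(cos t), by the three-term recurrence. This gives the case r = 0 by induction on n;
  the r extra steps average U_{2(b-d)} over the binomial weights of b, and that average is P. The
  substitution x = cos t gives the stated integral, and the limit is Laplace's method at t = 0 with
  t = u / sqrt(4 alpha (1 - alpha) n).
*)
theory Submission
  imports Defs "HOL-Real_Asymp.Real_Asymp"
begin

subsection \<open>Recursion for the tail probabilities\<close>

text \<open>The two point probabilities add up to 1, so \<open>U\<close> is almost surely
  \<open>v\<close> or 0; the event splits accordingly and independence factors each piece.\<close>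

lemma (in prob_space) prob_le_add_two_valued:
  fixes U W :: "'a \<Rightarrow> real" and \<alpha> m v :: real
  assumes indep: "indep_var borel U borel W"
    and v: "prob {\<omega> \<in> space M. U \<omega> = v} = \<alpha>"
    and z: "prob {\<omega> \<in> space M. U \<omega> = 0} = 1 - \<alpha>"
    and "v \<noteq> 0"
  shows "prob {\<omega> \<in> space M. m \<le> U \<omega> + W \<omega>} =
    \<alpha> * prob {\<omega> \<in> space M. m - v \<le> W \<omega>} + (1 - \<alpha>) * prob {\<omega> \<in> space M. m \<le> W \<omega>}"
proof -
  have rv: "U \<in> borel_measurable M" "W \<in> borel_measurable M"
    using indep unfolding indep_var_eq by auto
  note [measurable] = rv
  let ?E = "{\<omega> \<in> space M. m \<le> U \<omega> + W \<omega>}"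
  let ?V = "{\<omega> \<in> space M. U \<omega> = v}"
  let ?Z = "{\<omega> \<in> space M. U \<omega> = 0}"
  have sets: "?E \<in> events" "?V \<in> events" "?Z \<in> events" by measurable
  have prod: "prob {\<omega> \<in> space M. U \<omega> = u \<and> c \<le> W \<omega>} =
      prob {\<omega> \<in> space M. U \<omega> = u} * prob {\<omega> \<in> space M. c \<le> W \<omega>}" for u c
  proof -
    have "prob ((\<lambda>x. (U x, W x)) -` ({u} \<times> {c..}) \<inter> space M) =
        prob (U -` {u} \<inter> space M) * prob (W -` {c..} \<inter> space M)"
      by (rule indep_varD[OF indep]) auto
    moreover have "(\<lambda>x. (U x, W x)) -` ({u} \<times> {c..}) \<inter> space M = {\<omega> \<in> space M. U \<omega> = u \<and> c \<le> W \<omega>}"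
      "U -` {u} \<inter> space M = {\<omega> \<in> space M. U \<omega> = u}"
      "W -` {c..} \<inter> space M = {\<omega> \<in> space M. c \<le> W \<omega>}" by auto
    ultimately show ?thesis by simp
  qed
  have "prob (?V \<union> ?Z) = 1"
    using v z sets \<open>v \<noteq> 0\<close> by (subst finite_measure_Union) auto
  have "AE \<omega> in M. \<omega> \<in> ?V \<union> ?Z"
    using \<open>prob (?V \<union> ?Z) = 1\<close> by (subst AE_in_set_eq_1) (use sets in auto)
  then have "prob ?E = prob ({\<omega> \<in> space M. U \<omega> = v \<and> m - v \<le> W \<omega>} \<union> {\<omega> \<in> space M. U \<omega> = 0 \<and> m \<le> W \<omega>})"
    by (intro finite_measure_eq_AE) auto
  also have "\<dots> = prob {\<omega> \<in> space M. U \<omega> = v \<and> m - v \<le> W \<omega>} + prob {\<omega> \<in> space M. U \<omega> = 0 \<and> m \<le> W \<omega>}"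
    using \<open>v \<noteq> 0\<close> by (intro finite_measure_Union) auto
  finally show ?thesis by (simp add: prod v z)
qed

text \<open>Both recursions condition on the newest summand of the difference of the sums: it takes
  the values 1 and 0 for a new X, and -1 and 0 for a new X'.\<close>

lemma (in prob_space) partial_sum_le_step:
  fixes X X' :: "nat \<Rightarrow> 'a \<Rightarrow> real"
  assumes iid: "iid_bernoulli_pair M \<alpha> X X'"
  shows "prob {\<omega> \<in> space M. partial_sum X' n \<omega> + m \<le> partial_sum X (Suc k) \<omega>} =
      \<alpha> * prob {\<omega> \<in> space M. partial_sum X' n \<omega> + (m - 1) \<le> partial_sum X k \<omega>} +
      (1 - \<alpha>) * prob {\<omega> \<in> space M. partial_sum X' n \<omega> + m \<le> partial_sum X k \<omega>}" (is ?l)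
    and "prob {\<omega> \<in> space M. partial_sum X' (Suc n) \<omega> + m \<le> partial_sum X k \<omega>} =
      \<alpha> * prob {\<omega> \<in> space M. partial_sum X' n \<omega> + (m + 1) \<le> partial_sum X k \<omega>} +
      (1 - \<alpha>) * prob {\<omega> \<in> space M. partial_sum X' n \<omega> + m \<le> partial_sum X k \<omega>}" (is ?r)
proof -
  \<comment> \<open>Negating the primed variables turns the difference of the two partial sums into
    a single sum over one independent family, and the new index lies outside
    \<open>I k n\<close>.\<close>
  define Y where "Y = (\<lambda>i \<omega>. case_sum (\<lambda>_ x. x) (\<lambda>_ x. - x) i (case_sum X X' i \<omega>) :: real)"
  define I where "I k n = Inl ` {1..k} \<union> Inr ` {1..n}" for k n :: nat
  have Y: "indep_vars (\<lambda>_. borel) Y ({1..} <+> {1..})"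
    unfolding Y_def
    by (rule indep_vars_compose2[where M'="\<lambda>_. borel" and X="case_sum X X'"])
      (use iid in \<open>auto simp: iid_bernoulli_pair_def split: sum.split\<close>)
  have sum: "(\<Sum>i\<in>I k n. Y i \<omega>) = partial_sum X k \<omega> - partial_sum X' n \<omega>" for k n \<omega>
    unfolding I_def by (subst sum.union_disjoint)
      (auto simp: sum.reindex Y_def partial_sum_def sum_negf)
  have U: "indep_var borel (Y i) borel (\<lambda>\<omega>. \<Sum>i\<in>I k n. Y i \<omega>)"
    if "i = Inl (Suc k) \<or> i = Inr (Suc n)" for i
    by (intro indep_vars_sum indep_vars_subset[OF Y]) (use that in \<open>auto simp: I_def\<close>)
  have p: "prob {\<omega> \<in> space M. Y (Inl (Suc k)) \<omega> = 1} = \<alpha>"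
    "prob {\<omega> \<in> space M. Y (Inl (Suc k)) \<omega> = 0} = 1 - \<alpha>"
    "prob {\<omega> \<in> space M. Y (Inr (Suc n)) \<omega> = -1} = \<alpha>"
    "prob {\<omega> \<in> space M. Y (Inr (Suc n)) \<omega> = 0} = 1 - \<alpha>"
    using iid by (auto simp: iid_bernoulli_pair_def Y_def)
  have S: "partial_sum Z (Suc k) \<omega> = Z (Suc k) \<omega> + partial_sum Z k \<omega>" for Z k and \<omega> :: 'a
    by (simp add: partial_sum_def)
  show ?l
    using prob_le_add_two_valued[OF U p(1,2), of m]
    by (simp add: sum S) (simp add: Y_def algebra_simps)
  show ?r
    using prob_le_add_two_valued[OF U p(3,4), of m]
    by (simp add: sum S) (simp add: Y_def algebra_simps)
qed

text \<open>Induction on \<open>r\<close> with Pascal's rule. It serves twice: for the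
  \<open>r\<close> extra steps of the walk, and, with an affine \<open>f\<close>, for the binomial
  mean that gives P(1).\<close>

lemma pascal_iterate:
  fixes f :: "nat \<Rightarrow> int \<Rightarrow> real"
  assumes "\<And>r m. f (Suc r) m = \<alpha> * f r (m - 1) + (1 - \<alpha>) * f r m"
  shows "f r m = (\<Sum>b\<le>r. real (r choose b) * \<alpha> ^ b * (1 - \<alpha>) ^ (r - b) * f 0 (m - int b))"
proof (induction r arbitrary: m)
  case 0
  show ?case by simp
next
  case (Suc r)
  let ?g = "\<lambda>b. f 0 (m - int b)"
  have A: "\<alpha> * f r (m - 1) = (\<Sum>b\<le>r. real (r choose b) * \<alpha> ^ Suc b * (1 - \<alpha>) ^ (r - b) * ?g (Suc b))"
    unfolding Suc by (simp add: sum_distrib_left algebra_simps)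
  have "(1 - \<alpha>) * f r m = (\<Sum>b\<le>r. real (r choose b) * \<alpha> ^ b * (1 - \<alpha>) ^ (Suc r - b) * ?g b)"
    unfolding Suc sum_distrib_left by (intro sum.cong) (auto simp: Suc_diff_le)
  \<comment> \<open>The added term vanishes because \<open>r choose Suc r\<close> is 0; the longer
    range allows the index shift that lines up with the other sum.\<close>
  also have "\<dots> = (\<Sum>b\<le>Suc r. real (r choose b) * \<alpha> ^ b * (1 - \<alpha>) ^ (Suc r - b) * ?g b)"
    by simp
  also have "\<dots> = (1 - \<alpha>) ^ Suc r * ?g 0 +
      (\<Sum>b\<le>r. real (r choose Suc b) * \<alpha> ^ Suc b * (1 - \<alpha>) ^ (r - b) * ?g (Suc b))"
    by (subst sum.atMost_Suc_shift) simp
  finally have B: "(1 - \<alpha>) * f r m = \<dots>" .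
  show ?case
    unfolding assms A B
    by (subst sum.atMost_Suc_shift) (simp add: sum.distrib distrib_left distrib_right del: power_Suc)
qed

subsection \<open>Chebyshev polynomials of the second kind with even index\<close>

text \<open>This is the coefficient of (2x)^(2j) in U_{2l}(x). The generalized binomial and the
  integer power keep the formula valid for negative \<open>l\<close>. It is also the derivative of
  order 2j of t^(l+j) at t = -1, divided by (2j)!, which links it to P.\<close>

definition dirichlet_coeff :: "int \<Rightarrow> nat \<Rightarrow> real" where
  "dirichlet_coeff l j = (- 1) powi (l - int j) * (of_int (l + int j) gchoose (2 * j))"

text \<open>
  \<open>dirichlet_poly l\<close> at \<open>cos t\<close> is the Dirichlet kernel \<open>sin ((2l+1)t) / sin t\<close>, also for negative \<open>l\<close>.
\<close>

definition dirichlet_poly :: "int \<Rightarrow> real \<Rightarrow> real" where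
  "dirichlet_poly l x = (\<Sum>j\<le>nat \<bar>l\<bar>. dirichlet_coeff l j * (2 * x) ^ (2 * j))"

lemma dirichlet_coeff_eq_0:
  assumes "int j > \<bar>l\<bar>"
  shows "dirichlet_coeff l j = 0"
proof -
  have "(of_int (l + int j) :: real) = of_nat (nat (l + int j))"
    using assms by simp
  then have "((of_int (l + int j) :: real) gchoose (2 * j)) = of_nat (nat (l + int j) choose (2 * j))"
    by (simp only: binomial_gbinomial)
  moreover have "nat (l + int j) < 2 * j" using assms by linarith
  ultimately show ?thesis
    unfolding dirichlet_coeff_def by (simp only: binomial_eq_0 of_nat_0 mult_zero_right)
qed

text \<open>Padding with zero coefficients brings polynomials of different index to a common
  summation range.\<close>

lemma dirichlet_poly_eq_sum:
  assumes "\<bar>l\<bar> \<le> int N"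
  shows "dirichlet_poly l x = (\<Sum>j\<le>N. dirichlet_coeff l j * (2 * x) ^ (2 * j))"
  unfolding dirichlet_poly_def using assms
  by (intro sum.mono_neutral_left) (auto intro!: dirichlet_coeff_eq_0)

text \<open>Pascal's rule applied twice says that the second difference of
  \<open>a gchoose (k + 2)\<close> in \<open>a\<close> is \<open>a gchoose k\<close>. The sign
  (-1)^(l-j) alternates in \<open>l\<close>, which makes all signs on the left positive.\<close>

lemma dirichlet_coeff_second_difference:
  "dirichlet_coeff (l + 1) (Suc j) + dirichlet_coeff (l - 1) (Suc j) + 2 * dirichlet_coeff l (Suc j) =
    dirichlet_coeff l j"
proof -
  define a :: real where "a = of_int (l + int j)"
  have 1: "a + 1 + 1 gchoose Suc (Suc (2 * j)) =
      (a gchoose (2 * j)) + 2 * (a gchoose Suc (2 * j)) + (a gchoose Suc (Suc (2 * j)))"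
    "a + 1 gchoose Suc (Suc (2 * j)) = (a gchoose Suc (2 * j)) + (a gchoose Suc (Suc (2 * j)))"
    by (simp_all only: gbinomial_Suc_Suc)
  have 2: "of_int (l + 1 + int (Suc j)) = a + 1 + 1" "of_int (l - 1 + int (Suc j)) = a"
    "of_int (l + int (Suc j)) = a + 1" "2 * Suc j = Suc (Suc (2 * j))"
    by (simp_all add: a_def)
  have 3: "(- 1 :: real) powi (l + 1 - int (Suc j)) = (- 1) powi (l - int j)"
    "(- 1 :: real) powi (l - 1 - int (Suc j)) = (- 1) powi (l - int j)"
    "(- 1 :: real) powi (l - int (Suc j)) = - ((- 1) powi (l - int j))"
    by (simp_all add: power_int_diff power_int_add)
  show ?thesis
    unfolding dirichlet_coeff_def 2 3 1 by (simp add: a_def algebra_simps)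
qed

text \<open>Multiplication by 4x^2 shifts the coefficients by one place, so this is the second
  difference identity summed over \<open>j\<close>; the constant terms cancel by parity. At x = cos
  t the factor 4x^2 - 2 is 2 cos(2t).\<close>

lemma dirichlet_poly_rec:
  "dirichlet_poly (l + 1) x + dirichlet_poly (l - 1) x = (4 * x\<^sup>2 - 2) * dirichlet_poly l x"
proof -
  define N where "N = nat \<bar>l\<bar> + 1"
  have N: "dirichlet_poly (l + 1) x = (\<Sum>j\<le>Suc N. dirichlet_coeff (l + 1) j * (2 * x) ^ (2 * j))"
    "dirichlet_poly (l - 1) x = (\<Sum>j\<le>Suc N. dirichlet_coeff (l - 1) j * (2 * x) ^ (2 * j))"
    "dirichlet_poly l x = (\<Sum>j\<le>Suc N. dirichlet_coeff l j * (2 * x) ^ (2 * j))"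
    "dirichlet_poly l x = (\<Sum>j\<le>N. dirichlet_coeff l j * (2 * x) ^ (2 * j))"
    by (rule dirichlet_poly_eq_sum; simp add: N_def)+
  have 0: "dirichlet_coeff (l + 1) 0 + dirichlet_coeff (l - 1) 0 + 2 * dirichlet_coeff l 0 = 0"
    by (auto simp: dirichlet_coeff_def power_int_minus_left)
  have "dirichlet_poly (l + 1) x + dirichlet_poly (l - 1) x + 2 * dirichlet_poly l x =
      (\<Sum>j\<le>Suc N. (dirichlet_coeff (l + 1) j + dirichlet_coeff (l - 1) j + 2 * dirichlet_coeff l j) * (2 * x) ^ (2 * j))"
    unfolding N(1-3) by (simp add: sum_distrib_left sum.distrib distrib_right mult.assoc del: sum.atMost_Suc)
  also have "\<dots> = (\<Sum>j\<le>N. dirichlet_coeff l j * (2 * x) ^ (2 * Suc j))"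
    by (subst sum.atMost_Suc_shift) (simp only: dirichlet_coeff_second_difference 0 mult_zero_left add_0)
  also have "\<dots> = 4 * x\<^sup>2 * dirichlet_poly l x"
    unfolding N(4) sum_distrib_left by (intro sum.cong) (auto simp: power_mult_distrib power2_eq_square algebra_simps)
  finally show ?thesis by (simp add: algebra_simps)
qed

lemma dirichlet_poly_0 [simp]: "dirichlet_poly 0 x = 1"
  and dirichlet_poly_minus_1 [simp]: "dirichlet_poly (- 1) x = - 1"
  by (simp_all add: dirichlet_poly_def dirichlet_coeff_def gbinomial_0_left numeral_2_eq_2 atMost_Suc)

text \<open>The difference form of the Dirichlet kernel formula avoids division by sin t and so
  includes t = 0. Both sides satisfy the same three-term recurrence in \<open>l\<close> and agree at
  \<open>l = 0\<close> and \<open>l = 1\<close>; the induction carries two consecutive indices and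
  runs in both directions.\<close>

lemma dirichlet_poly_cos_diff:
  "dirichlet_poly l (cos t) - dirichlet_poly (l - 1) (cos t) = 2 * cos (2 * of_int l * t)"
proof -
  let ?P = "\<lambda>l. dirichlet_poly l (cos t) - dirichlet_poly (l - 1) (cos t) = 2 * cos (2 * of_int l * t)"
  have rec: "2 * cos (2 * of_int (l + 1) * t) + 2 * cos (2 * of_int (l - 1) * t) =
      (4 * (cos t)\<^sup>2 - 2) * (2 * cos (2 * of_int l * t))" for l :: int
  proof -
    have "2 * cos (2 * of_int (l + 1) * t) + 2 * cos (2 * of_int (l - 1) * t) =
        2 * cos (2 * of_int l * t + 2 * t) + 2 * cos (2 * of_int l * t - 2 * t)"
      by (simp add: algebra_simps)
    also have "\<dots> = 4 * cos (2 * of_int l * t) * cos (2 * t)"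
      by (simp only: cos_add cos_diff) simp
    finally show ?thesis unfolding cos_double_cos by (simp only: algebra_simps)
  qed
  have rec': "dirichlet_poly (l + 1) (cos t) - dirichlet_poly l (cos t) +
      (dirichlet_poly (l - 1) (cos t) - dirichlet_poly (l - 2) (cos t)) =
      (4 * (cos t)\<^sup>2 - 2) * (dirichlet_poly l (cos t) - dirichlet_poly (l - 1) (cos t))" for l
    using dirichlet_poly_rec[of l "cos t"] dirichlet_poly_rec[of "l - 1" "cos t"]
    by (simp add: algebra_simps)
  have "?P l \<and> ?P (l + 1)"
  proof (induction l rule: int_induct[where k=0])
    case base
    show ?case using dirichlet_poly_rec[of 0 "cos t"] by (simp add: cos_double_cos)
  next
    case (step1 l)
    then show ?case using rec[of "l + 1"] rec'[of "l + 1"] by (simp add: algebra_simps)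
  next
    case (step2 l)
    then show ?case using rec[of l] rec'[of l] by (simp add: algebra_simps)
  qed
  then show ?thesis by simp
qed

text \<open>At t = 0 consecutive values differ by 2, so they telescope from
  \<open>l = 0\<close>.\<close>

lemma dirichlet_poly_1 [simp]: "dirichlet_poly l 1 = 2 * of_int l + 1"
proof (induction l rule: int_induct[where k=0])
  case (step1 l)
  then show ?case using dirichlet_poly_cos_diff[of "l + 1" 0] by simp
next
  case (step2 l)
  then show ?case using dirichlet_poly_cos_diff[of l 0] by simp
qed simp

lemma continuous_on_dirichlet_poly [continuous_intros]:
  "continuous_on A f \<Longrightarrow> continuous_on A (\<lambda>x. dirichlet_poly l (f x))"
  unfolding dirichlet_poly_def by (intro continuous_intros)

text \<open>The weights are the probabilities that a difference X - X' equals 0, 1 and -1, since Q =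
  \<alpha>^2 + (1 - \<alpha>)^2 + \<alpha>(1 - \<alpha>)(4x^2 - 2).\<close>

lemma Q_poly_mult_dirichlet_poly:
  "Q_poly \<alpha> x * dirichlet_poly l x = (\<alpha>\<^sup>2 + (1 - \<alpha>)\<^sup>2) * dirichlet_poly l x +
    \<alpha> * (1 - \<alpha>) * (dirichlet_poly (l + 1) x + dirichlet_poly (l - 1) x)"
  unfolding dirichlet_poly_rec Q_poly_def by (simp add: power2_eq_square algebra_simps)

text \<open>For \<open>l\<close> other than 0, cos(2lt) integrates to 0 over [0, pi/2], so passing
  from \<open>l - 1\<close> to \<open>l\<close> changes nothing; the only jump is between -1 and
  0.\<close>

lemma integral_dirichlet_poly_cos:
  "integral {0..pi / 2} (\<lambda>t. dirichlet_poly l (cos t)) = (if l \<ge> 0 then pi / 2 else - (pi / 2))"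
proof -
  let ?J = "\<lambda>l. integral {0..pi / 2} (\<lambda>t. dirichlet_poly l (cos t))"
  have step: "?J l = ?J (l - 1)" if "l \<noteq> 0" for l
  proof -
    have "((\<lambda>t. 2 * cos (2 * of_int l * t)) has_integral
        sin (2 * of_int l * (pi / 2)) / of_int l - sin (2 * of_int l * 0) / of_int l) {0..pi / 2}"
      using that by (intro fundamental_theorem_of_calculus)
        (auto intro!: derivative_eq_intros simp flip: has_real_derivative_iff_has_vector_derivative)
    moreover have "sin (2 * of_int l * (pi / 2)) = 0"
      by (simp add: mult.commute sin_integer_2pi)
    ultimately have "integral {0..pi / 2} (\<lambda>t. 2 * cos (2 * of_int l * t)) = 0"
      by (intro integral_unique) simp
    moreover have "?J l - ?J (l - 1) = integral {0..pi / 2} (\<lambda>t. 2 * cos (2 * of_int l * t))"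
      unfolding dirichlet_poly_cos_diff [symmetric]
      by (intro Henstock_Kurzweil_Integration.integral_diff [symmetric] integrable_continuous_interval continuous_intros)
    ultimately show ?thesis by simp
  qed
  show ?thesis
  proof (induction l rule: int_induct[where k=0])
    case (step1 l)
    then show ?case using step[of "l + 1"] by simp
  next
    case (step2 l)
    then show ?case using step[of l] by (cases "l = 0") auto
  qed simp
qed

subsection \<open>Derivatives and integrals\<close>

text \<open>The representation is required only on the negative half-line: this set is open, so the
  derivatives agree there, it contains -1, and it avoids the singularity of negative powers at 0.
  The product of \<open>fact k\<close> and the binomial is the falling factorial.\<close>

lemma higher_deriv_sum_power_int:
  fixes c :: "'i \<Rightarrow> real" and e :: "'i \<Rightarrow> int"
  assumes "\<And>t. t < 0 \<Longrightarrow> f t = (\<Sum>i\<in>I. c i * t powi e i)" and "t < 0"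
  shows "(deriv ^^ k) f t = (\<Sum>i\<in>I. c i * (fact k * (of_int (e i) gchoose k)) * t powi (e i - int k))"
  using assms(2)
proof (induction k arbitrary: t)
  case 0
  then show ?case using assms(1) by simp
next
  case (Suc k)
  let ?g = "\<lambda>t. \<Sum>i\<in>I. c i * (fact k * (of_int (e i) gchoose k)) * t powi (e i - int k)"
  have "eventually (\<lambda>s. s \<in> {..<0::real}) (nhds t)"
    using Suc.prems by (intro eventually_nhds_in_open) auto
  then have "eventually (\<lambda>s. (deriv ^^ k) f s = ?g s) (nhds t)"
    by eventually_elim (use Suc.IH in auto)
  then have "deriv ((deriv ^^ k) f) t = deriv ?g t"
    by (rule deriv_cong_ev) simp
  also have "\<dots> = (\<Sum>i\<in>I. c i * (fact k * (of_int (e i) gchoose k)) *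
      (of_int (e i - int k) * t powi (e i - int k - 1)))"
    using Suc.prems by (intro DERIV_imp_deriv) (auto intro!: derivative_eq_intros sum.cong)
  also have "\<dots> = (\<Sum>i\<in>I. c i * (fact (Suc k) * (of_int (e i) gchoose Suc k)) *
      t powi (e i - int (Suc k)))"
  proof (intro sum.cong refl)
    fix i
    have "(fact k * (of_int (e i) gchoose k)) * of_int (e i - int k) =
        (fact (Suc k) * (of_int (e i) gchoose Suc k) :: real)"
      unfolding gbinomial_mult_fact by simp
    moreover have "e i - int k - 1 = e i - int (Suc k)" by simp
    ultimately show "c i * (fact k * (of_int (e i) gchoose k)) * (of_int (e i - int k) * t powi (e i - int k - 1)) =
       c i * (fact (Suc k) * (of_int (e i) gchoose Suc k)) * t powi (e i - int (Suc k))"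
      by (metis mult.assoc)
  qed
  finally show ?case by simp
qed

section \<open>The substitution x = cos t\<close>

text \<open>The Jacobian sin t cancels the weight, which equals 1 / sin t at x = cos t. The change
  of variables transfers absolute integrability together with the value, so the singularity at x = 1
  calls for no estimate of its own.\<close>

lemma 
  fixes f :: "real \<Rightarrow> real"
  assumes f: "continuous_on {0..1} f"
  shows set_integrable_arccos_substitution: "set_integrable lborel {0<..<1} (\<lambda>x. f x * (1 - x\<^sup>2) powr (- 1 / 2))"
    and set_integral_arccos_substitution: "(LINT x:{0<..<1}|lborel. f x * (1 - x\<^sup>2) powr (- 1 / 2)) =
      integral {0..pi / 2} (\<lambda>t. f (cos t))"
proof -
  let ?h = "\<lambda>x. f x * (1 - x\<^sup>2) powr (- 1 / 2)"
  let ?S = "{0<..<pi / 2}"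
  have img: "cos ` ?S = {0<..<1}"
  proof (intro equalityI subsetI)
    fix y assume "y \<in> cos ` ?S"
    then obtain t where "y = cos t" "0 < t" "t < pi / 2" by auto
    then show "y \<in> {0<..<1}" using cos_gt_zero_pi[of t] cos_monotone_0_pi[of 0 t] by auto
  next
    fix y :: real assume "y \<in> {0<..<1}"
    then show "y \<in> cos ` ?S"
      using arccos_lt_bounded[of y] arccos_less_arccos[of 0 y] by (intro image_eqI[of _ _ "arccos y"]) (auto simp: cos_arccos)
  qed
  have inj: "inj_on cos ?S"
    by (auto simp: inj_on_def intro: cos_inj_pi)
  have cont: "continuous_on {0..pi / 2} (\<lambda>t. f (cos t))"
    by (intro continuous_on_compose2[OF f] continuous_intros) (auto intro!: cos_ge_zero intro: order_trans[OF _ pi_ge_zero])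
  have "set_integrable lborel {0..pi / 2} (\<lambda>t. f (cos t))"
    by (rule borel_integrable_atLeastAtMost') (rule cont)
  then have "set_integrable lborel ?S (\<lambda>t. f (cos t))"
    by (rule set_integrable_subset) auto
  then have ai: "(\<lambda>t. f (cos t)) absolutely_integrable_on ?S"
    unfolding set_integrable_def by (subst integrable_completion) (auto dest: borel_measurable_integrable)
  have eq: "\<bar>- sin t\<bar> * ?h (cos t) = f (cos t)" if "t \<in> ?S" for t
  proof -
    have s: "sin t > 0" using that by (intro sin_gt_zero) auto
    have "1 - (cos t)\<^sup>2 = (sin t)\<^sup>2" by (simp add: sin_squared_eq)
    then have "(1 - (cos t)\<^sup>2) powr (- 1 / 2) = (sin t powr 2) powr (- 1 / 2)" using s by simp
    also have "\<dots> = inverse (sin t)" using s by (subst powr_powr) (simp add: powr_minus)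
    finally show ?thesis using s by simp
  qed
  have "(\<lambda>t. \<bar>- sin t\<bar> * ?h (cos t)) absolutely_integrable_on ?S"
    by (rule iffD2[OF set_integrable_cong[OF refl refl eq] ai])
  moreover have "integral ?S (\<lambda>t. \<bar>- sin t\<bar> * ?h (cos t)) = integral ?S (\<lambda>t. f (cos t))"
    by (rule integral_cong[OF eq])
  ultimately have "(\<lambda>t. \<bar>- sin t\<bar> * ?h (cos t)) absolutely_integrable_on ?S \<and>
      integral ?S (\<lambda>t. \<bar>- sin t\<bar> * ?h (cos t)) = integral ?S (\<lambda>t. f (cos t))" ..
  then have "?h absolutely_integrable_on {0<..<1} \<and> integral {0<..<1} ?h = integral ?S (\<lambda>t. f (cos t))"
    unfolding img [symmetric]
    by (intro iffD1[OF has_absolute_integral_change_of_variables_1'[where g' = "\<lambda>t. - sin t", OF _ _ inj]])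
      (auto intro!: derivative_eq_intros)
  then have h: "?h absolutely_integrable_on {0<..<1}" "integral {0<..<1} ?h = integral ?S (\<lambda>t. f (cos t))"
    by auto
  \<comment> \<open>Absolute integrability refers to the completed Lebesgue measure; Borel
    measurability of the integrand brings the result back to \<open>lborel\<close>.\<close>
  have "set_borel_measurable borel {0<..<1} ?h"
  proof -
    have "1 - x\<^sup>2 \<noteq> 0" if "x \<in> {0<..<1}" for x :: real
      using that abs_square_less_1[of x] by auto
    then have "continuous_on {0<..<1} ?h"
      by (intro continuous_intros continuous_on_subset[OF f]) auto
    then show ?thesis
      unfolding set_borel_measurable_def by (intro borel_measurable_continuous_on_indicator) auto
  qed
  then have m: "(\<lambda>x. indicator {0<..<1} x *\<^sub>R ?h x) \<in> borel_measurable lborel"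
    by (simp add: set_borel_measurable_def)
  show i: "set_integrable lborel {0<..<1} ?h"
    using h(1) unfolding set_integrable_def by (subst (asm) integrable_completion[OF m])
  have "(LINT x:{0<..<1}|lborel. ?h x) = integral {0<..<1} ?h"
    by (rule set_borel_integral_eq_integral(2)[OF i])
  then show "(LINT x:{0<..<1}|lborel. ?h x) = integral {0..pi / 2} (\<lambda>t. f (cos t))"
    unfolding h(2) integral_open_interval_real .
qed

section \<open>Laplace's method for powers of 1 - c sin^2 t\<close>

text \<open>A crude bound that suffices for a Gaussian majorant: sin t is at least t - t^3/6, and t
  at most 2 gives t^3 at most 4t.\<close>

lemma sin_ge_third:
  fixes t :: real
  assumes "0 \<le> t" "t \<le> pi / 2"
  shows "t / 3 \<le> sin t"
proof -
  have "\<bar>sin t - (\<Sum>m<3. sin_coeff m * t ^ m)\<bar> \<le> inverse (fact 3) * \<bar>t\<bar> ^ 3"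
    by (rule Maclaurin_sin_bound)
  then have "t - t ^ 3 / 6 \<le> sin t"
    using assms by (simp add: sin_coeff_def numeral_3_eq_3 fact_numeral abs_if field_simps split: if_splits)
  moreover have "t ^ 3 \<le> 4 * t"
  proof -
    have "t \<le> 2" using assms pi_half_less_two by linarith
    then have "t ^ 2 \<le> 2 ^ 2" using assms by (intro power_mono) auto
    then have "t * t ^ 2 \<le> t * 2 ^ 2" using assms by (intro mult_left_mono) auto
    then show ?thesis by (simp add: power2_eq_square power3_eq_cube)
  qed
  ultimately show ?thesis by linarith
qed

text \<open>After the scaling t = u / s_n the integrand tends to g(0) exp(-u^2) for u at least 0 and
  is dominated by a multiple of exp(-(u/3)^2); the half-line Gaussian integral is
  sqrt(pi)/2.\<close>

lemma laplace_sin_limit: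
  fixes g :: "real \<Rightarrow> real"
  assumes g: "continuous_on {0..pi / 2} g" and c: "0 < c" "c \<le> 1"
  shows "(\<lambda>n. sqrt (real n) * integral {0..pi / 2} (\<lambda>t. (1 - c * (sin t)\<^sup>2) ^ n * g t))
    \<longlonglongrightarrow> g 0 * sqrt pi / (2 * sqrt c)"
proof -
  \<comment> \<open>Extension by zero replaces the growing range [0, s_n pi/2] of \<open>u\<close>
    by the whole line, as dominated convergence needs a fixed domain.\<close>
  define G where "G t = indicator {0..pi / 2} t *\<^sub>R g t" for t
  \<comment> \<open>The shift to \<open>Suc n\<close> keeps the scale positive for every
    \<open>n\<close>; it is undone at the end, as it does not affect the limit.\<close>
  define s where "s n = sqrt (c * real (Suc n))" for n
  define F where "F n u = (1 - c * (sin (u / s n))\<^sup>2) ^ Suc n * G (u / s n)" for n u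
  have s: "s n > 0" for n using c by (simp add: s_def)
  have s2: "(s n)\<^sup>2 = c * real (Suc n)" for n using c by (simp add: s_def del: of_nat_Suc)
  have [measurable]: "G \<in> borel_measurable borel"
    unfolding G_def using g by (intro borel_measurable_continuous_on_indicator) auto
  have "bounded (g ` {0..pi / 2})"
    by (intro compact_imp_bounded compact_continuous_image g) auto
  then obtain K where K: "\<And>t. t \<in> {0..pi / 2} \<Longrightarrow> \<bar>g t\<bar> \<le> K"
    unfolding bounded_iff by (metis imageI real_norm_def)
  have K0: "0 \<le> K" using K[of 0] by auto

  have scale: "sqrt (real (Suc n)) * integral {0..pi / 2} (\<lambda>t. (1 - c * (sin t)\<^sup>2) ^ Suc n * g t) =
      (1 / sqrt c) * (\<integral>u. F n u \<partial>lborel)" for n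
  proof -
    let ?h = "\<lambda>t. (1 - c * (sin t)\<^sup>2) ^ Suc n * g t"
    have "set_integrable lborel {0..pi / 2} ?h"
      by (intro borel_integrable_atLeastAtMost' continuous_intros g)
    then have "integral {0..pi / 2} ?h = (LINT t:{0..pi / 2}|lborel. ?h t)"
      by (rule set_borel_integral_eq_integral(2) [symmetric])
    also have "\<dots> = (\<integral>t. (1 - c * (sin t)\<^sup>2) ^ Suc n * G t \<partial>lborel)"
      unfolding set_lebesgue_integral_def G_def by (intro Bochner_Integration.integral_cong) auto
    also have "\<dots> = (1 / s n) * (\<integral>u. F n u \<partial>lborel)"
      using lborel_integral_real_affine[of "1 / s n" "\<lambda>t. (1 - c * (sin t)\<^sup>2) ^ Suc n * G t" 0] s[of n]
      by (simp add: F_def)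
    finally have "integral {0..pi / 2} ?h = (1 / s n) * (\<integral>u. F n u \<partial>lborel)" .
    then show ?thesis using c by (simp add: s_def real_sqrt_mult del: of_nat_Suc)
  qed

  \<comment> \<open>Combine 1 - y at most exp(-y) with sin t at least t/3; the exponent (n+1) c
    (t/3)^2 is exactly (u/3)^2.\<close>
  have bound: "norm (F n u) \<le> K * (indicator {0..} (1 / 3 * u) *\<^sub>R exp (- (1 / 3 * u)\<^sup>2))" for n u
  proof (cases "u / s n \<in> {0..pi / 2}")
    case True
    define t where "t = u / s n"
    have t: "0 \<le> t" "t \<le> pi / 2" using True by (auto simp: t_def)
    have u: "u = s n * t" using s[of n] by (simp add: t_def)
    have u0: "0 \<le> u" using t s[of n] by (simp add: u)
    have le1: "c * (sin t)\<^sup>2 \<le> 1" using c by (intro mult_le_one) (auto simp: abs_square_le_1)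
    have "(t / 3)\<^sup>2 \<le> (sin t)\<^sup>2" using sin_ge_third[OF t] t by (intro power_mono) auto
    then have "c * (t / 3)\<^sup>2 \<le> c * (sin t)\<^sup>2" using c by simp
    moreover have "1 - c * (sin t)\<^sup>2 \<le> exp (- (c * (sin t)\<^sup>2))"
      using exp_ge_add_one_self[of "- (c * (sin t)\<^sup>2)"] by simp
    ultimately have "1 - c * (sin t)\<^sup>2 \<le> exp (- (c * (t / 3)\<^sup>2))"
      by (meson exp_le_cancel_iff neg_le_iff_le order_trans)
    then have "(1 - c * (sin t)\<^sup>2) ^ Suc n \<le> exp (- (c * (t / 3)\<^sup>2)) ^ Suc n"
      using le1 by (intro power_mono) auto
    also have "\<dots> = exp (- (1 / 3 * u)\<^sup>2)"
      by (subst exp_of_nat_mult [symmetric]) (simp add: u power_mult_distrib s2 power_divide del: of_nat_Suc)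
    finally have "(1 - c * (sin t)\<^sup>2) ^ Suc n * \<bar>g t\<bar> \<le> exp (- (1 / 3 * u)\<^sup>2) * K"
      using K[of t] t le1 by (intro mult_mono) auto
    moreover have "norm (F n u) = (1 - c * (sin t)\<^sup>2) ^ Suc n * \<bar>g t\<bar>"
      using t le1 by (simp add: F_def G_def t_def [symmetric] abs_mult power_abs)
    ultimately show ?thesis using u0 by (simp add: mult.commute)
  qed (use K0 in \<open>auto simp: F_def G_def\<close>)

  have lim: "(\<lambda>n. F n u) \<longlonglongrightarrow> (indicator {0..} u *\<^sub>R exp (- u\<^sup>2)) * g 0" for u
  proof (cases "u \<ge> 0")
    case False
    then have "u / s n < 0" for n using s[of n] by (simp add: divide_neg_pos)
    then show ?thesis using False by (simp add: F_def G_def not_le)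
  next
    case True
    have "filterlim s at_top sequentially"
      unfolding s_def using c by real_asymp
    then have us: "(\<lambda>n. u / s n) \<longlonglongrightarrow> 0"
      by (intro tendsto_divide_0[OF tendsto_const] filterlim_at_top_imp_at_infinity)
    have pos: "0 \<le> u / s n" for n using s[of n] True by simp
    \<comment> \<open>For fixed \<open>u\<close> the scaled point eventually enters the interval on
      which \<open>g\<close> is continuous and \<open>G\<close> agrees with it.\<close>
    have "\<forall>\<^sub>F n in sequentially. u / s n < pi / 2"
      using order_tendstoD(2)[OF us, of "pi / 2"] by simp
    then have ev: "\<forall>\<^sub>F n in sequentially. u / s n \<in> {0..pi / 2}"
      by eventually_elim (use pos in auto)
    have "(\<lambda>n. g (u / s n)) \<longlonglongrightarrow> g 0"
      by (rule continuous_on_tendsto_compose[OF g us _ ev]) auto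
    moreover have "\<forall>\<^sub>F n in sequentially. g (u / s n) = G (u / s n)"
      using ev by eventually_elim (simp add: G_def)
    ultimately have "(\<lambda>n. G (u / s n)) \<longlonglongrightarrow> g 0"
      using filterlim_cong by force
    moreover have "(\<lambda>n. (1 - c * (sin (u / s n))\<^sup>2) ^ Suc n) \<longlonglongrightarrow> exp (- u\<^sup>2)"
    \<comment> \<open>At \<open>u = 0\<close> every term is 1. For positive \<open>u\<close> the
      expression behaves like (1 - u^2/(n+1))^(n+1), because s_n^2 = c(n+1).\<close>
    proof (cases "u = 0")
      case False
      then have "u > 0" using True by simp
      then have "(\<lambda>n. (1 - c * (sin (u / s n))\<^sup>2) ^ Suc n)
          \<longlonglongrightarrow> exp (- (c * (u * inverse (c powr (1 / 2)))\<^sup>2))"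
        unfolding s_def using c by real_asymp
      moreover have "c * (u * inverse (c powr (1 / 2)))\<^sup>2 = u\<^sup>2"
        using c by (simp add: powr_half_sqrt power_mult_distrib power_inverse)
      ultimately show ?thesis by simp
    qed simp
    ultimately have "(\<lambda>n. F n u) \<longlonglongrightarrow> exp (- u\<^sup>2) * g 0"
      unfolding F_def by (intro tendsto_mult)
    then show ?thesis using True by simp
  qed

  have "(\<lambda>n. \<integral>u. F n u \<partial>lborel) \<longlonglongrightarrow> (\<integral>u. (indicator {0..} u *\<^sub>R exp (- u\<^sup>2)) * g 0 \<partial>lborel)"
  proof (rule integral_dominated_convergence)
    have "integrable lborel (\<lambda>u. indicator {0..} (0 + 1 / 3 * u) *\<^sub>R exp (- (0 + 1 / 3 * u)\<^sup>2) :: real)"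
      using gaussian_moment_0 by (intro lborel_integrable_real_affine) (auto simp: has_bochner_integral_iff)
    then show "integrable lborel (\<lambda>u. K * (indicator {0..} (1 / 3 * u) *\<^sub>R exp (- (1 / 3 * u)\<^sup>2)))"
      by simp
    show "F n \<in> borel_measurable lborel" for n unfolding F_def by measurable
  qed (use lim bound in auto)
  also have "(\<integral>u. (indicator {0..} u *\<^sub>R exp (- u\<^sup>2)) * g 0 \<partial>lborel) = sqrt pi / 2 * g 0"
    using gaussian_moment_0 by (simp add: has_bochner_integral_iff)
  finally have "(\<lambda>n. (1 / sqrt c) * (\<integral>u. F n u \<partial>lborel)) \<longlonglongrightarrow> (1 / sqrt c) * (sqrt pi / 2 * g 0)"
    by (intro tendsto_mult tendsto_const)
  then show ?thesis
    unfolding scale [symmetric]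
    by (subst filterlim_sequentially_Suc [symmetric]) (simp add: mult_ac)
qed

subsection \<open>The integral representation\<close>

text \<open>Both sides obey the same recursion in \<open>n\<close>, and at \<open>n = 0\<close> both
  are the indicator of \<open>m \<le> 0\<close>. The induction keeps \<open>m\<close> arbitrary
  because one round involves \<open>m - 1\<close> and \<open>m + 1\<close>.\<close>

lemma (in prob_space) prob_partial_sum_eq_integral:
  assumes iid: "iid_bernoulli_pair M \<alpha> X X'"
  shows "prob {\<omega> \<in> space M. partial_sum X' n \<omega> + real_of_int m \<le> partial_sum X n \<omega>} =
    1 / 2 + 1 / pi * integral {0..pi / 2} (\<lambda>t. Q_poly \<alpha> (cos t) ^ n * dirichlet_poly (- m) (cos t))"
proof (induction n arbitrary: m)
  case 0
  have "{\<omega> \<in> space M. partial_sum X' 0 \<omega> + real_of_int m \<le> partial_sum X 0 \<omega>} =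
      (if m \<le> 0 then space M else {})"
    by (auto simp: partial_sum_def)
  then show ?case
    by (simp add: integral_dirichlet_poly_cos prob_space)
next
  case (Suc n)
  define J where "J m = integral {0..pi / 2} (\<lambda>t. Q_poly \<alpha> (cos t) ^ n * dirichlet_poly (- m) (cos t))" for m
  have int: "(\<lambda>t. Q_poly \<alpha> (cos t) ^ n * dirichlet_poly l (cos t)) integrable_on {0..pi / 2}" for l
    unfolding Q_poly_def by (intro integrable_continuous_interval continuous_intros)
  have "integral {0..pi / 2} (\<lambda>t. Q_poly \<alpha> (cos t) ^ Suc n * dirichlet_poly (- m) (cos t)) =
      integral {0..pi / 2} (\<lambda>t. (\<alpha>\<^sup>2 + (1 - \<alpha>)\<^sup>2) * (Q_poly \<alpha> (cos t) ^ n * dirichlet_poly (- m) (cos t)) +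
        \<alpha> * (1 - \<alpha>) * (Q_poly \<alpha> (cos t) ^ n * dirichlet_poly (- (m - 1)) (cos t) +
          Q_poly \<alpha> (cos t) ^ n * dirichlet_poly (- (m + 1)) (cos t)))"
  proof (intro Henstock_Kurzweil_Integration.integral_cong)
    fix t
    have "Q_poly \<alpha> (cos t) ^ Suc n * dirichlet_poly (- m) (cos t) =
        Q_poly \<alpha> (cos t) ^ n * (Q_poly \<alpha> (cos t) * dirichlet_poly (- m) (cos t))" by simp
    also have "\<dots> = (\<alpha>\<^sup>2 + (1 - \<alpha>)\<^sup>2) * (Q_poly \<alpha> (cos t) ^ n * dirichlet_poly (- m) (cos t)) +
        \<alpha> * (1 - \<alpha>) * (Q_poly \<alpha> (cos t) ^ n * dirichlet_poly (- m + 1) (cos t) +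
          Q_poly \<alpha> (cos t) ^ n * dirichlet_poly (- m - 1) (cos t))"
      unfolding Q_poly_mult_dirichlet_poly by (simp only: algebra_simps)
    finally show "Q_poly \<alpha> (cos t) ^ Suc n * dirichlet_poly (- m) (cos t) =
        (\<alpha>\<^sup>2 + (1 - \<alpha>)\<^sup>2) * (Q_poly \<alpha> (cos t) ^ n * dirichlet_poly (- m) (cos t)) +
        \<alpha> * (1 - \<alpha>) * (Q_poly \<alpha> (cos t) ^ n * dirichlet_poly (- (m - 1)) (cos t) +
          Q_poly \<alpha> (cos t) ^ n * dirichlet_poly (- (m + 1)) (cos t))"
      by simp
  qed
  also have "\<dots> = (\<alpha>\<^sup>2 + (1 - \<alpha>)\<^sup>2) * J m + \<alpha> * (1 - \<alpha>) * (J (m - 1) + J (m + 1))"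
    unfolding J_def
    by (intro integral_unique has_integral_add has_integral_mult_right integrable_integral int)
  finally have J: "integral {0..pi / 2} (\<lambda>t. Q_poly \<alpha> (cos t) ^ Suc n * dirichlet_poly (- m) (cos t)) = \<dots>" .
  \<comment> \<open>One round adds X' first and then X; sums of unequal length occur only at this
    intermediate stage.\<close>
  have step: "prob {\<omega> \<in> space M. partial_sum X' (Suc n) \<omega> + real_of_int m \<le> partial_sum X n \<omega>} =
      \<alpha> * (1 / 2 + 1 / pi * J (m + 1)) + (1 - \<alpha>) * (1 / 2 + 1 / pi * J m)" for m
    using partial_sum_le_step(2)[OF iid, of n "real_of_int m" n] Suc.IH[of "m + 1"] Suc.IH[of m]
    by (simp add: J_def)
  have "prob {\<omega> \<in> space M. partial_sum X' (Suc n) \<omega> + real_of_int m \<le> partial_sum X (Suc n) \<omega>} =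
      \<alpha> * (\<alpha> * (1 / 2 + 1 / pi * J m) + (1 - \<alpha>) * (1 / 2 + 1 / pi * J (m - 1))) +
      (1 - \<alpha>) * (\<alpha> * (1 / 2 + 1 / pi * J (m + 1)) + (1 - \<alpha>) * (1 / 2 + 1 / pi * J m))"
    using partial_sum_le_step(1)[OF iid, of "Suc n" "real_of_int m" n] step[of "m - 1"] step[of m]
    by simp
  also have "\<dots> = 1 / 2 + 1 / pi * ((\<alpha>\<^sup>2 + (1 - \<alpha>)\<^sup>2) * J m + \<alpha> * (1 - \<alpha>) * (J (m - 1) + J (m + 1)))"
  proof -
    have "\<alpha> * (\<alpha> * (1 / 2 + q * x) + (1 - \<alpha>) * (1 / 2 + q * y)) +
        (1 - \<alpha>) * (\<alpha> * (1 / 2 + q * z) + (1 - \<alpha>) * (1 / 2 + q * x)) =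
        1 / 2 + q * ((\<alpha>\<^sup>2 + (1 - \<alpha>)\<^sup>2) * x + \<alpha> * (1 - \<alpha>) * (y + z))" for q x y z
      by (simp add: power2_eq_square field_simps)
    then show ?thesis .
  qed
  finally show ?case unfolding J .
qed

text \<open>The binomial theorem turns the differentiated function into a combination of the powers
  t^(j+l) with l = b - d, whose derivatives of order 2j at -1 are (2j)! times
  \<open>dirichlet_coeff l j\<close>. Exchanging the sums leaves complete polynomials, since |b - d|
  is at most r + d.\<close>

lemma P_poly_eq_sum_dirichlet_poly:
  "P_poly \<alpha> r d x =
    (\<Sum>b\<le>r. real (r choose b) * \<alpha> ^ b * (1 - \<alpha>) ^ (r - b) * dirichlet_poly (int b - int d) x)"
proof -
  define w where "w b = real (r choose b) * \<alpha> ^ b * (1 - \<alpha>) ^ (r - b)" for b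
  have expand: "t powi e * (1 - \<alpha> + \<alpha> * t) ^ r = (\<Sum>b\<le>r. w b * t powi (e + int b))" if "t < 0" for t e
  proof -
    have "(1 - \<alpha> + \<alpha> * t) ^ r = (\<alpha> * t + (1 - \<alpha>)) ^ r" by (simp add: add.commute)
    also have "\<dots> = (\<Sum>b\<le>r. w b * t ^ b)"
      unfolding binomial_ring w_def by (simp add: power_mult_distrib mult_ac)
    finally show ?thesis
      using that by (simp add: sum_distrib_left power_int_add mult_ac)
  qed
  have deriv: "(deriv ^^ (2 * j)) (\<lambda>t. t powi (int j - int d) * (1 - \<alpha> + \<alpha> * t) ^ r) (- 1) =
      (\<Sum>b\<le>r. w b * (fact (2 * j) * dirichlet_coeff (int b - int d) j))" for j
  proof -
    have e: "int j - int d + int b - int (2 * j) = int b - int d - int j" 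
      "int j - int d + int b = int b - int d + int j" for b by simp_all
    show ?thesis
      by (subst higher_deriv_sum_power_int[OF expand])
        (simp_all add: e dirichlet_coeff_def mult_ac del: of_int_diff of_int_add)
  qed
  have "P_poly \<alpha> r d x = (\<Sum>j\<le>r + d. \<Sum>b\<le>r. w b * (dirichlet_coeff (int b - int d) j * (2 * x) ^ (2 * j)))"
    unfolding P_poly_def deriv sum_distrib_right atLeast0AtMost by (intro sum.cong) auto
  also have "\<dots> = (\<Sum>b\<le>r. \<Sum>j\<le>r + d. w b * (dirichlet_coeff (int b - int d) j * (2 * x) ^ (2 * j)))"
    by (rule sum.swap)
  also have "\<dots> = (\<Sum>b\<le>r. w b * dirichlet_poly (int b - int d) x)"
    unfolding sum_distrib_left [symmetric]
    by (intro sum.cong refl arg_cong2[where f="(*)"] dirichlet_poly_eq_sum [symmetric]) auto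
  finally show ?thesis unfolding w_def .
qed

text \<open>P(1) is the binomial average of 2(b - d) + 1. The affine function 2 \<alpha> r - 2m + 1
  satisfies the averaging recursion and reduces to these values at \<open>r = 0\<close>.\<close>

lemma P_poly_1: "P_poly \<alpha> r d 1 = 2 * \<alpha> * real r - 2 * real d + 1"
  using pascal_iterate[of "\<lambda>r m. 2 * \<alpha> * real r - 2 * of_int m + 1" \<alpha> r "int d"]
  unfolding P_poly_eq_sum_dirichlet_poly by (simp add: algebra_simps)

text \<open>The \<open>r\<close> extra steps average the case of equal lengths over the thresholds d
  - b with binomial weights. The weights sum to 1, which preserves the constant 1/2, and they
  assemble the kernels into P.\<close>

lemma (in prob_space) lead_prob_eq_integral:
  assumes iid: "iid_bernoulli_pair M \<alpha> X X'"
  shows "lead_prob M X X' r d n =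
    1 / 2 + 1 / pi * integral {0..pi / 2} (\<lambda>t. Q_poly \<alpha> (cos t) ^ n * P_poly \<alpha> r d (cos t))"
proof -
  define w where "w b = real (r choose b) * \<alpha> ^ b * (1 - \<alpha>) ^ (r - b)" for b
  define p where "p r m = prob {\<omega> \<in> space M. partial_sum X' n \<omega> + real_of_int m \<le> partial_sum X (n + r) \<omega>}" for r m
  define J where "J l = integral {0..pi / 2} (\<lambda>t. Q_poly \<alpha> (cos t) ^ n * dirichlet_poly l (cos t))" for l
  have int: "(\<lambda>t. Q_poly \<alpha> (cos t) ^ n * dirichlet_poly l (cos t)) integrable_on {0..pi / 2}" for l
    unfolding Q_poly_def by (intro integrable_continuous_interval continuous_intros)
  have total: "(\<Sum>b\<le>r. w b) = 1"
    using binomial_ring[of \<alpha> "1 - \<alpha>" r] by (simp add: w_def)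
  have "lead_prob M X X' r d n = p r (int d)"
    by (simp add: lead_prob_def p_def)
  also have "\<dots> = (\<Sum>b\<le>r. w b * p 0 (int d - int b))"
    unfolding w_def
    by (rule pascal_iterate) (use partial_sum_le_step(1)[OF iid] in \<open>simp add: p_def\<close>)
  also have "\<dots> = (\<Sum>b\<le>r. w b * (1 / 2 + 1 / pi * J (int b - int d)))"
  proof (intro sum.cong refl)
    fix b
    show "w b * p 0 (int d - int b) = w b * (1 / 2 + 1 / pi * J (int b - int d))"
      using prob_partial_sum_eq_integral[OF iid, of n "int d - int b"] by (simp add: p_def J_def)
  qed
  also have "\<dots> = (\<Sum>b\<le>r. w b) * (1 / 2) + 1 / pi * (\<Sum>b\<le>r. w b * J (int b - int d))"
    by (simp add: distrib_left sum.distrib sum_distrib_left sum_distrib_right sum_divide_distrib mult_ac)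
  also have "(\<Sum>b\<le>r. w b * J (int b - int d)) =
      integral {0..pi / 2} (\<lambda>t. \<Sum>b\<le>r. w b * (Q_poly \<alpha> (cos t) ^ n * dirichlet_poly (int b - int d) (cos t)))"
    unfolding J_def
    by (intro integral_unique [symmetric] has_integral_sum has_integral_mult_right integrable_integral int) auto
  also have "\<dots> = integral {0..pi / 2} (\<lambda>t. Q_poly \<alpha> (cos t) ^ n * P_poly \<alpha> r d (cos t))"
    unfolding P_poly_eq_sum_dirichlet_poly w_def [symmetric] sum_distrib_left by (simp add: mult_ac)
  finally show ?thesis by (simp add: total)
qed

section \<open>The integral over (0,1) and the limit\<close>

theorem theorem1:
  fixes M :: "'a measure" and X X' :: "nat \<Rightarrow> 'a \<Rightarrow> real"
    and \<alpha> :: real and r d :: nat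
  assumes "prob_space M"
    and "0 < \<alpha>" and "\<alpha> < 1"
    and "iid_bernoulli_pair M \<alpha> X X'"
    and "r \<ge> 1" and "d \<ge> 1"
  shows "(\<forall>n\<ge>1.
            set_integrable lborel {0<..<1}
              (\<lambda>x. Q_poly \<alpha> x ^ n * (1 - x\<^sup>2) powr (- 1 / 2) * P_poly \<alpha> r d x) \<and>
            lead_prob M X X' r d n =
              1 / 2 + 1 / pi *
                (LINT x:{0<..<1}|lborel.
                   Q_poly \<alpha> x ^ n * (1 - x\<^sup>2) powr (- 1 / 2) * P_poly \<alpha> r d x)) \<and>
         (\<lambda>n. sqrt (real n) * (lead_prob M X X' r d n - 1 / 2)) \<longlonglongrightarrow>
            1 / (4 * sqrt pi) * ((2 * \<alpha> * real r - 2 * real d + 1) / sqrt (\<alpha> * (1 - \<alpha>)))"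
proof (intro conjI allI impI)
  interpret prob_space M by fact
  note iid = assms(4)
  let ?f = "\<lambda>n x. Q_poly \<alpha> x ^ n * P_poly \<alpha> r d x"
  have cont: "continuous_on A (\<lambda>x. P_poly \<alpha> r d x)" for A
    unfolding P_poly_eq_sum_dirichlet_poly by (intro continuous_intros)
  have fcont: "continuous_on {0..1} (?f n)" for n
    unfolding Q_poly_def by (intro continuous_intros cont)
  fix n :: nat
  have eq: "(\<lambda>x. Q_poly \<alpha> x ^ n * (1 - x\<^sup>2) powr (- 1 / 2) * P_poly \<alpha> r d x) =
      (\<lambda>x. ?f n x * (1 - x\<^sup>2) powr (- 1 / 2))" by (simp add: mult_ac)
  show "set_integrable lborel {0<..<1}
      (\<lambda>x. Q_poly \<alpha> x ^ n * (1 - x\<^sup>2) powr (- 1 / 2) * P_poly \<alpha> r d x)"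
    unfolding eq by (rule set_integrable_arccos_substitution[OF fcont])
  show "lead_prob M X X' r d n = 1 / 2 + 1 / pi *
      (LINT x:{0<..<1}|lborel. Q_poly \<alpha> x ^ n * (1 - x\<^sup>2) powr (- 1 / 2) * P_poly \<alpha> r d x)"
    unfolding eq set_integral_arccos_substitution[OF fcont] by (rule lead_prob_eq_integral[OF iid])
next
  interpret prob_space M by fact
  define c where "c = 4 * (\<alpha> * (1 - \<alpha>))"
  have c: "0 < c" using assms(2,3) by (simp add: c_def)
  have "1 - c = (2 * \<alpha> - 1)\<^sup>2" by (simp add: c_def power2_eq_square algebra_simps)
  then have c1: "c \<le> 1" using zero_le_power2[of "2 * \<alpha> - 1"] by linarith
  \<comment> \<open>This is the Laplace form: Q peaks at t = 0 with value 1, so the limit sees P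
    only through P(cos 0) = P(1).\<close>
  have Q: "Q_poly \<alpha> (cos t) = 1 - c * (sin t)\<^sup>2" for t
    by (simp add: Q_poly_def c_def sin_squared_eq)
  have "continuous_on {0..pi / 2} (\<lambda>t. P_poly \<alpha> r d (cos t))"
    unfolding P_poly_eq_sum_dirichlet_poly by (intro continuous_intros)
  from laplace_sin_limit[OF this c c1]
  have "(\<lambda>n. 1 / pi * (sqrt (real n) * integral {0..pi / 2} (\<lambda>t. (1 - c * (sin t)\<^sup>2) ^ n * P_poly \<alpha> r d (cos t))))
      \<longlonglongrightarrow> 1 / pi * (P_poly \<alpha> r d (cos 0) * sqrt pi / (2 * sqrt c))"
    by (intro tendsto_mult tendsto_const)
  moreover have "1 / pi * (P_poly \<alpha> r d (cos 0) * sqrt pi / (2 * sqrt c)) =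
      1 / (4 * sqrt pi) * ((2 * \<alpha> * real r - 2 * real d + 1) / sqrt (\<alpha> * (1 - \<alpha>)))"
  proof -
    have "sqrt c = 2 * sqrt (\<alpha> * (1 - \<alpha>))" by (simp add: c_def real_sqrt_mult)
    then have "1 / pi * (P_poly \<alpha> r d (cos 0) * sqrt pi / (2 * sqrt c)) =
        sqrt pi / pi * (P_poly \<alpha> r d 1 / (4 * sqrt (\<alpha> * (1 - \<alpha>))))" by simp
    also have "sqrt pi / pi = 1 / sqrt pi" by (simp add: field_simps)
    finally show ?thesis by (simp add: P_poly_1)
  qed
  ultimately show "(\<lambda>n. sqrt (real n) * (lead_prob M X X' r d n - 1 / 2)) \<longlonglongrightarrow>
      1 / (4 * sqrt pi) * ((2 * \<alpha> * real r - 2 * real d + 1) / sqrt (\<alpha> * (1 - \<alpha>)))"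
    by (simp add: lead_prob_eq_integral[OF assms(4)] Q mult_ac)
qed

end
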